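(* Let $G$ be a finite non-nilpotent group whose nilpotentizer $\mathrm{nil}(G)$ has even order. Then the nilpotent graph $\Gamma_{\mathfrak N}(G)$ is non-Eulerian.
   Context: For a finite group $G$, the nilpotentizer of $G$ is $\mathrm{nil}(G)=\{g\in G:\langle g,h\rangle \text{ is nilpotent for all } h\in G\}$; for finite $G$ it is a subgroup, equal to the hypercenter of $G$. For a finite non-nilpotent group $G$, the nilpotent graph $\Gamma_{\mathfrak N}(G)$ is the simple undirected graph with vertex set $G-\mathrm{nil}(G)$ (set difference) in which two distinct vertices $g,h$ are adjacent if and only if $\langle g,h\rangle$ is nilpotent. A graph is Eulerian if it has a closed trail traversing every edge exactly once (and visiting every vertex). *)

theory Defs
  imports "HOL-Algebra.Generated_Groups"
begin

section \<open>Nilpotent groups\<close>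

definition commutator_subgroup ::
    "('a, 'b) monoid_scheme \<Rightarrow> 'a set \<Rightarrow> 'a set \<Rightarrow> 'a set" where
  "commutator_subgroup G H K =
     generate G (\<Union>h\<in>H. \<Union>k\<in>K. {h \<otimes>\<^bsub>G\<^esub> k \<otimes>\<^bsub>G\<^esub> inv\<^bsub>G\<^esub> h \<otimes>\<^bsub>G\<^esub> inv\<^bsub>G\<^esub> k})"

primrec lower_central :: "('a, 'b) monoid_scheme \<Rightarrow> nat \<Rightarrow> 'a set" where
  "lower_central G 0 = carrier G"
| "lower_central G (Suc n) = commutator_subgroup G (lower_central G n) (carrier G)"

definition nilpotent_group :: "('a, 'b) monoid_scheme \<Rightarrow> bool" where
  "nilpotent_group G \<longleftrightarrow> group G \<and> (\<exists>n. lower_central G n = {\<one>\<^bsub>G\<^esub>})"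

definition nilpotent_pair :: "('a, 'b) monoid_scheme \<Rightarrow> 'a \<Rightarrow> 'a \<Rightarrow> bool" where
  "nilpotent_pair G g h \<longleftrightarrow> nilpotent_group (G\<lparr>carrier := generate G {g, h}\<rparr>)"

definition nilpotentizer :: "('a, 'b) monoid_scheme \<Rightarrow> 'a set" where
  "nilpotentizer G = {g \<in> carrier G. \<forall>h \<in> carrier G. nilpotent_pair G g h}"

section \<open>Simple graphs and Eulerian graphs\<close>

text \<open>
  A simple undirected graph is the pair of its vertex set and its edge set, an edge being the
  two-element set of its ends. (The closed Euler trails of \<open>Graph_Theory\<close> are directed: in the
  symmetric digraph of a simple graph they would traverse every edge once in each direction.)
\<close>

type_synonym 'a sgraph = "'a set \<times> 'a set set"

definition walk_edges :: "'a list \<Rightarrow> 'a set list" where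
  "walk_edges w = map (\<lambda>(x, y). {x, y}) (zip w (tl w))"

text \<open>
  The list \<open>w\<close> below is the sequence of vertices of a closed walk, with the initial vertex repeated
  at the end. That consecutive vertices are adjacent is part of the last conjunct. The walk with a
  single vertex and no edge is allowed.
\<close>

definition eulerian :: "'a sgraph \<Rightarrow> bool" where
  "eulerian \<Gamma> \<longleftrightarrow>
     (\<exists>w. w \<noteq> [] \<and> hd w = last w \<and> set w = fst \<Gamma> \<and>
          distinct (walk_edges w) \<and> set (walk_edges w) = snd \<Gamma>)"

definition nilpotent_graph :: "('a, 'b) monoid_scheme \<Rightarrow> 'a sgraph" where
  "nilpotent_graph G =
     (carrier G - nilpotentizer G,
      {{g, h} | g h. g \<in> carrier G - nilpotentizer G \<and> h \<in> carrier G - nilpotentizer G \<and>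
                     g \<noteq> h \<and> nilpotent_pair G g h})"

end

theory Submission
  imports Defs "HOL-Algebra.Sylow" "HOL-Algebra.Zassenhaus" "HOL-Algebra.Multiplicative_Group"
begin

text \<open>
  In an Eulerian graph every vertex has even degree, because a closed walk enters a vertex as often
  as it leaves it. In the nilpotent graph every vertex has odd degree when the nilpotentizer \<open>N\<close> has
  even order. Indeed the elements that generate a nilpotent group together with a vertex \<open>g\<close> are the
  neighbours of \<open>g\<close>, the elements of \<open>N\<close>, and \<open>g\<close> itself, so that the degree of \<open>g\<close> is
  \<open>|D| - |N| - 1\<close>, where \<open>D\<close> is the set of these elements, and it remains to see that \<open>|D|\<close> is even.
  The walk of an Eulerian graph is nonempty, so there is a vertex to look at.

  If \<open>t\<close> is a central element of order 2, then \<open>h \<mapsto> h t\<close> is a fixed-point-free involution of \<open>D\<close>: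
  modulo the central subgroup \<open>{1, t}\<close> the groups generated by \<open>g, h\<close> and by \<open>g, h t\<close> are the same.
  Hence \<open>|D|\<close> is even, and all that is needed is such a \<open>t\<close>
  (\<open>even_nilpotentizer_central_involution\<close>). It is found by counting, without identifying \<open>N\<close>
  with the hypercenter, and even without knowing that \<open>N\<close> is a subgroup:

  \<^item> \<open>N\<close> is closed under inverses and contains \<open>1\<close>, so the set \<open>I\<close> of its elements of order 2 has
    odd size. It is closed under conjugation.
  \<^item> In a nilpotent group, elements of order 2 commute with elements of odd order
    (\<open>nilpotent_involution_commutes_odd\<close>). Since every element of \<open>I\<close> generates a nilpotent group
    with any other element, it commutes with all elements of odd order.
  \<^item> As \<open>|I|\<close> is odd, some \<open>t\<close> in \<open>I\<close> has a conjugacy class of odd size, that is, a centralizer of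
    odd index. For every odd prime the centralizer contains a Sylow subgroup, so no odd prime divides
    this index, which is therefore 1 (\<open>odd_conj_invariant_set_contains_central\<close>).
\<close>

section \<open>Parity of sets with an involution\<close>

lemma even_card_involution_moved:
  assumes "finite A" "\<And>x. x \<in> A \<Longrightarrow> f x \<in> A" "\<And>x. x \<in> A \<Longrightarrow> f (f x) = x"
    "\<And>x. x \<in> A \<Longrightarrow> f x \<noteq> x"
  shows "even (card A)"
  using assms
proof (induction A rule: finite_psubset_induct)
  case (psubset A)
  show ?case
  proof (cases "A = {}")
    case False
    then obtain x where x: "x \<in> A" by blast
    let ?B = "A - {x, f x}"
    have fx: "f x \<in> A" "f x \<noteq> x" "f (f x) = x" using psubset.prems x by auto
    have "even (card ?B)"
    proof (rule psubset.IH)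
      show "?B \<subset> A" using x by blast
      fix y assume y: "y \<in> ?B"
      then show "f (f y) = y" "f y \<noteq> y" using psubset.prems by auto
      have "f y \<noteq> x" "f y \<noteq> f x" using y psubset.prems x by (metis DiffE insertCI)+
      then show "f y \<in> ?B" using y psubset.prems(1) by auto
    qed
    moreover have "card A = card ?B + 2"
    proof -
      have "card {x, f x} \<le> card A" using x fx psubset.hyps by (intro card_mono) auto
      moreover have "card ?B = card A - card {x, f x}"
        using x fx by (intro card_Diff_subset) auto
      ultimately show ?thesis using fx(2) by auto
    qed
    ultimately show ?thesis by simp
  qed simp
qed

lemma even_card_involution_iff:
  assumes "finite A" "\<And>x. x \<in> A \<Longrightarrow> f x \<in> A" "\<And>x. x \<in> A \<Longrightarrow> f (f x) = x"
  shows "even (card A) \<longleftrightarrow> even (card {x \<in> A. f x = x})"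
proof -
  have "even (card {x \<in> A. f x \<noteq> x})"
    using assms by (intro even_card_involution_moved[where f = f]) auto
  moreover have "card A = card {x \<in> A. f x = x} + card {x \<in> A. f x \<noteq> x}"
    using assms(1) by (subst card_Un_disjoint[symmetric]) (auto intro!: arg_cong[where f = card])
  ultimately show ?thesis by simp
qed

section \<open>Degrees in Eulerian graphs\<close>

text \<open>
  Each visit of a vertex uses two edges of the walk, except that the visits at the two ends use one
  each; adding these ends makes the count even. Loops are excluded, as a loop would be counted once
  although it is used both for leaving and for entering its vertex.
\<close>
lemma even_walk_edges_at_vertex:
  assumes "w \<noteq> []" "\<And>x. {x} \<notin> set (walk_edges w)"
  shows "even (length (filter (\<lambda>e. v \<in> e) (walk_edges w)) + of_bool (hd w = v) + of_bool (last w = v))"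
  using assms
proof (induction w rule: induct_list012)
  case (3 x y zs)
  have *: "walk_edges (x # y # zs) = {x, y} # walk_edges (y # zs)"
    by (simp add: walk_edges_def)
  have "x \<noteq> y" using 3(4)[of x] * by auto
  moreover have "even (length (filter (\<lambda>e. v \<in> e) (walk_edges (y # zs)))
    + of_bool (hd (y # zs) = v) + of_bool (last (y # zs) = v))"
    using 3(4) * by (intro 3(2)) auto
  ultimately show ?case unfolding * by (auto split: if_splits)
qed (auto simp: walk_edges_def)

lemma eulerian_even_degree:
  assumes "eulerian \<Gamma>" "\<And>x. {x} \<notin> snd \<Gamma>"
  shows "even (card {e \<in> snd \<Gamma>. v \<in> e})"
proof -
  obtain w where w: "w \<noteq> []" "hd w = last w" "distinct (walk_edges w)"
      "set (walk_edges w) = snd \<Gamma>"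
    using assms(1) unfolding eulerian_def by blast
  have "even (length (filter (\<lambda>e. v \<in> e) (walk_edges w)))"
    using even_walk_edges_at_vertex[of w v] w assms(2) by auto
  also have "length (filter (\<lambda>e. v \<in> e) (walk_edges w)) = card {e \<in> snd \<Gamma>. v \<in> e}"
    using w(3,4) by (metis distinct_card distinct_filter set_filter)
  finally show ?thesis .
qed

section \<open>The lower central series\<close>

context group
begin

lemma commutators_in_carrier:
  assumes "A \<subseteq> carrier G" "B \<subseteq> carrier G"
  shows "(\<Union>h\<in>A. \<Union>k\<in>B. {h \<otimes> k \<otimes> inv h \<otimes> inv k}) \<subseteq> carrier G"
  using assms by blast

lemma commutator_subgroup_is_subgroup:
  assumes "A \<subseteq> carrier G" "B \<subseteq> carrier G"
  shows "subgroup (commutator_subgroup G A B) G"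
  unfolding commutator_subgroup_def
  by (intro generate_is_subgroup commutators_in_carrier assms)

lemma commutator_in_commutator_subgroup:
  assumes "h \<in> A" "k \<in> B"
  shows "h \<otimes> k \<otimes> inv h \<otimes> inv k \<in> commutator_subgroup G A B"
  unfolding commutator_subgroup_def using assms by (intro generate.incl) blast

lemma commutator_subgroup_least:
  assumes "subgroup H G" "\<And>h k. h \<in> A \<Longrightarrow> k \<in> B \<Longrightarrow> h \<otimes> k \<otimes> inv h \<otimes> inv k \<in> H"
  shows "commutator_subgroup G A B \<subseteq> H"
  unfolding commutator_subgroup_def using assms by (intro generate_subgroup_incl) auto

lemma commutator_eq_one_iff:
  assumes "x \<in> carrier G" "y \<in> carrier G"
  shows "x \<otimes> y \<otimes> inv x \<otimes> inv y = \<one> \<longleftrightarrow> x \<otimes> y = y \<otimes> x"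
proof -
  have "x \<otimes> y \<otimes> inv x \<otimes> inv y = x \<otimes> y \<otimes> inv (y \<otimes> x)"
    using assms by (simp add: inv_mult_group m_assoc)
  then show ?thesis
    using assms inv_solve_right'[of "\<one>" "x \<otimes> y" "y \<otimes> x"] by auto
qed

lemma conjugation_group_hom:
  assumes x: "x \<in> carrier G"
  shows "group_hom G G (\<lambda>y. x \<otimes> y \<otimes> inv x)"
proof -
  have "x \<otimes> (y \<otimes> z) \<otimes> inv x = (x \<otimes> y \<otimes> inv x) \<otimes> (x \<otimes> z \<otimes> inv x)"
    if "y \<in> carrier G" "z \<in> carrier G" for y z
  proof -
    have "inv x \<otimes> (x \<otimes> (z \<otimes> inv x)) = z \<otimes> inv x"
      using that x by (simp add: m_assoc[symmetric])
    then show ?thesis using that x by (simp add: m_assoc)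
  qed
  then show ?thesis
    using x by unfold_locales (auto intro!: homI)
qed

text \<open>
  Conjugation is an automorphism, so it permutes the commutators that generate the next term.
\<close>
lemma lower_central_normal: "lower_central G n \<lhd> G"
proof (induction n)
  case 0
  show ?case by (auto intro: normal_invI subgroup_self)
next
  case (Suc n)
  let ?N = "lower_central G n"
  have sub: "?N \<subseteq> carrier G" using Suc normal_imp_subgroup subgroup.subset by blast
  show ?case
    unfolding lower_central.simps commutator_subgroup_def
  proof (rule normal_generateI)
    show "(\<Union>h\<in>?N. \<Union>k\<in>carrier G. {h \<otimes> k \<otimes> inv h \<otimes> inv k}) \<subseteq> carrier G"
      by (intro commutators_in_carrier sub subset_refl)
    fix c x
    assume "c \<in> (\<Union>h\<in>?N. \<Union>k\<in>carrier G. {h \<otimes> k \<otimes> inv h \<otimes> inv k})" and x: "x \<in> carrier G"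
    then obtain h k where hk: "h \<in> ?N" "k \<in> carrier G" "c = h \<otimes> k \<otimes> inv h \<otimes> inv k" by blast
    let ?h = "x \<otimes> h \<otimes> inv x" and ?k = "x \<otimes> k \<otimes> inv x"
    have h: "h \<in> carrier G" using hk(1) sub by blast
    have "x \<otimes> c \<otimes> inv x = ?h \<otimes> ?k \<otimes> inv ?h \<otimes> inv ?k"
    proof -
      interpret \<phi>: group_hom G G "\<lambda>y. x \<otimes> y \<otimes> inv x" by (rule conjugation_group_hom[OF x])
      show ?thesis
        unfolding hk(3) using h hk(2) \<phi>.hom_mult \<phi>.hom_inv by simp
    qed
    moreover have "?h \<in> ?N" using normal_invE(2)[OF Suc x hk(1)] .
    ultimately show "x \<otimes> c \<otimes> inv x \<in> (\<Union>h\<in>?N. \<Union>k\<in>carrier G. {h \<otimes> k \<otimes> inv h \<otimes> inv k})"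
      using x hk(2) by blast
  qed
qed

lemma lower_central_in_carrier: "lower_central G n \<subseteq> carrier G"
  using lower_central_normal normal_imp_subgroup subgroup.subset by blast

text \<open>
  The lower central series of a subgroup can be computed with the operations of the whole group.
  This makes the series of different subgroups comparable.
\<close>
lemma lower_central_subgroup_Suc:
  assumes "subgroup K G"
  shows "lower_central (G\<lparr>carrier := K\<rparr>) (Suc n) =
    commutator_subgroup G (lower_central (G\<lparr>carrier := K\<rparr>) n) K"
proof -
  let ?A = "lower_central (G\<lparr>carrier := K\<rparr>) n"
  have A: "?A \<subseteq> K"
    using group.lower_central_in_carrier[OF subgroup_imp_group[OF assms]] by simp
  have eq: "(\<Union>h\<in>?A. \<Union>k\<in>K. {h \<otimes> k \<otimes> inv\<^bsub>G\<lparr>carrier := K\<rparr>\<^esub> h \<otimes> inv\<^bsub>G\<lparr>carrier := K\<rparr>\<^esub> k}) =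
      (\<Union>h\<in>?A. \<Union>k\<in>K. {h \<otimes> k \<otimes> inv h \<otimes> inv k})"
    using A by (intro SUP_cong refl) (auto simp: m_inv_consistent[OF assms])
  have "(\<Union>h\<in>?A. \<Union>k\<in>K. {h \<otimes> k \<otimes> inv h \<otimes> inv k}) \<subseteq> K"
    using A assms by (auto intro!: subgroup.m_closed subgroup.m_inv_closed)
  then show ?thesis
    unfolding lower_central.simps commutator_subgroup_def
    using eq generate_consistent[OF _ assms] by simp
qed

lemma nilpotent_subgroup_iff:
  assumes "subgroup K G"
  shows "nilpotent_group (G\<lparr>carrier := K\<rparr>) \<longleftrightarrow> (\<exists>n. lower_central (G\<lparr>carrier := K\<rparr>) n = {\<one>})"
  unfolding nilpotent_group_def using subgroup_imp_group[OF assms] by simp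

lemma commutative_subgroup_nilpotent:
  assumes "subgroup K G" "\<And>x y. x \<in> K \<Longrightarrow> y \<in> K \<Longrightarrow> x \<otimes> y = y \<otimes> x"
  shows "nilpotent_group (G\<lparr>carrier := K\<rparr>)"
proof -
  have "commutator_subgroup G K K \<subseteq> {\<one>}"
    using assms subgroup.mem_carrier[OF assms(1)]
    by (intro commutator_subgroup_least triv_subgroup) (simp add: commutator_eq_one_iff)
  moreover have "\<one> \<in> commutator_subgroup G K K"
    unfolding commutator_subgroup_def by (rule generate.one)
  ultimately have "lower_central (G\<lparr>carrier := K\<rparr>) (Suc 0) = {\<one>}"
    unfolding lower_central_subgroup_Suc[OF assms(1)] by auto
  then show ?thesis using nilpotent_subgroup_iff[OF assms(1)] by blast
qed

lemma commutator_mult_central: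
  assumes "x \<in> carrier G" "y \<in> carrier G" "z \<in> carrier G" "w \<in> carrier G"
    "\<And>u. u \<in> carrier G \<Longrightarrow> z \<otimes> u = u \<otimes> z" "\<And>u. u \<in> carrier G \<Longrightarrow> w \<otimes> u = u \<otimes> w"
  shows "(x \<otimes> z) \<otimes> (y \<otimes> w) \<otimes> inv (x \<otimes> z) \<otimes> inv (y \<otimes> w) = x \<otimes> y \<otimes> inv x \<otimes> inv y"
proof -
  let ?u = "z \<otimes> w" and ?v = "inv x \<otimes> inv y"
  have xy: "(x \<otimes> z) \<otimes> (y \<otimes> w) = (x \<otimes> y) \<otimes> ?u"
    using assms by (metis m_assoc m_closed)
  have "(y \<otimes> w) \<otimes> (x \<otimes> z) = (y \<otimes> x) \<otimes> ?u"
    using assms by (metis m_assoc m_closed)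
  then have "inv ((y \<otimes> w) \<otimes> (x \<otimes> z)) = inv ((y \<otimes> x) \<otimes> ?u)" by simp
  then have inv_xy: "inv (x \<otimes> z) \<otimes> inv (y \<otimes> w) = inv ?u \<otimes> ?v"
    using assms(1-4) by (simp only: inv_mult_group m_closed)
  have u: "?u \<in> carrier G" and v: "?v \<in> carrier G" using assms(1-4) by simp_all
  then have cancel: "?u \<otimes> (inv ?u \<otimes> ?v) = ?v"
    by (metis inv_closed l_one m_assoc r_inv)
  have "(x \<otimes> z) \<otimes> (y \<otimes> w) \<otimes> inv (x \<otimes> z) \<otimes> inv (y \<otimes> w) =
      ((x \<otimes> z) \<otimes> (y \<otimes> w)) \<otimes> (inv (x \<otimes> z) \<otimes> inv (y \<otimes> w))"
    using assms(1-4) by (intro m_assoc) auto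
  also have "\<dots> = (x \<otimes> y) \<otimes> (?u \<otimes> (inv ?u \<otimes> ?v))"
    unfolding xy inv_xy using assms(1,2) u v by (intro m_assoc) auto
  also have "\<dots> = x \<otimes> y \<otimes> inv x \<otimes> inv y"
    unfolding cancel using assms(1,2) by (intro m_assoc[symmetric]) auto
  finally show ?thesis .
qed

text \<open>
  Commutators do not change when central factors are inserted, so every commutator of elements of
  \<open>L\<close> is a commutator of elements of \<open>K\<close>. From the second term on, the lower central series of \<open>L\<close> is
  therefore contained in that of \<open>K\<close>.
\<close>
lemma nilpotent_subgroup_mult_central:
  assumes K: "subgroup K G" and L: "subgroup L G"
    and Z: "subgroup Z G" "\<And>z u. z \<in> Z \<Longrightarrow> u \<in> carrier G \<Longrightarrow> z \<otimes> u = u \<otimes> z"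
    and LK: "L \<subseteq> K <#> Z"
    and nil: "nilpotent_group (G\<lparr>carrier := K\<rparr>)"
  shows "nilpotent_group (G\<lparr>carrier := L\<rparr>)"
proof -
  let ?k = "lower_central (G\<lparr>carrier := K\<rparr>)" and ?l = "lower_central (G\<lparr>carrier := L\<rparr>)"
  have kK: "?k n \<subseteq> K" for n
    using group.lower_central_in_carrier[OF subgroup_imp_group[OF K], of n] by simp
  have K': "K \<subseteq> carrier G" and Z': "Z \<subseteq> carrier G" using subgroup.subset[OF K] subgroup.subset[OF Z(1)] by auto
  have step: "commutator_subgroup G (?l n) L \<subseteq> ?k (Suc n)" if sub: "?l n \<subseteq> ?k n <#> Z" for n
    unfolding lower_central_subgroup_Suc[OF K]
  proof (rule commutator_subgroup_least)
    show "subgroup (commutator_subgroup G (?k n) K) G"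
      using kK K' by (intro commutator_subgroup_is_subgroup) blast+
    fix a b assume "a \<in> ?l n" "b \<in> L"
    then obtain x z y w where xy: "x \<in> ?k n" "z \<in> Z" "a = x \<otimes> z" "y \<in> K" "w \<in> Z" "b = y \<otimes> w"
      using sub LK unfolding set_mult_def by blast
    have "a \<otimes> b \<otimes> inv a \<otimes> inv b = x \<otimes> y \<otimes> inv x \<otimes> inv y"
      unfolding xy(3,6) using xy Z kK[of n] K' Z' by (intro commutator_mult_central) auto
    then show "a \<otimes> b \<otimes> inv a \<otimes> inv b \<in> commutator_subgroup G (?k n) K"
      using commutator_in_commutator_subgroup xy by metis
  qed
  have *: "?l n \<subseteq> ?k n <#> Z" for n
  proof (induction n)
    case 0 show ?case using LK by simp
  next
    case (Suc n)
    have "x \<in> ?k (Suc n) <#> Z" if "x \<in> ?k (Suc n)" for x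
    proof -
      have "x = x \<otimes> \<one>" using that kK[of "Suc n"] K' by auto
      then show ?thesis using that subgroup.one_closed[OF Z(1)] unfolding set_mult_def by blast
    qed
    then show ?case using step[OF Suc] unfolding lower_central_subgroup_Suc[OF L] by blast
  qed
  obtain n where n: "?k n = {\<one>}" using nil nilpotent_subgroup_iff[OF K] by blast
  \<comment> \<open>If \<open>n = 0\<close>, then \<open>K\<close> is trivial but \<open>L\<close> is only known to lie in \<open>Z\<close>; so go one term further.\<close>
  have "?k (Suc n) \<subseteq> {\<one>}"
    unfolding lower_central_subgroup_Suc[OF K] n
    using K' by (intro commutator_subgroup_least triv_subgroup) auto
  then have "?l (Suc n) \<subseteq> {\<one>}"
    using step[OF *] unfolding lower_central_subgroup_Suc[OF L] by blast
  moreover have "\<one> \<in> ?l (Suc n)"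
    unfolding lower_central_subgroup_Suc[OF L] commutator_subgroup_def by (rule generate.one)
  ultimately show ?thesis using nilpotent_subgroup_iff[OF L] by blast
qed

end

section \<open>Involutions and elements of odd order\<close>

context group
begin

text \<open>
  If the commutator \<open>c\<close> of \<open>t\<close> and \<open>g\<close> commutes with both, then conjugation by \<open>t\<close> maps \<open>g\<close> to
  \<open>c g\<close>, hence \<open>g\<^sup>n\<close> to \<open>c\<^sup>n g\<^sup>n\<close>, and its square maps \<open>g\<close> to \<open>c\<^sup>2 g\<close>. So \<open>c\<^sup>2\<close> and an odd
  power of \<open>c\<close> are both trivial.
\<close>
lemma involution_odd_commutator_trivial:
  assumes t: "t \<in> carrier G" "t \<otimes> t = \<one>"
    and g: "g \<in> carrier G" "g [^] k = \<one>" "odd (k :: nat)"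
    and c: "c = t \<otimes> g \<otimes> inv t \<otimes> inv g" "c \<otimes> t = t \<otimes> c" "c \<otimes> g = g \<otimes> c"
  shows "c = \<one>"
proof -
  have cc: "c \<in> carrier G" using c(1) t g by simp
  have it: "inv t = t" using t(1,2) by (simp add: inv_equality)
  have tg: "t \<otimes> g = c \<otimes> g \<otimes> t"
    using t g c(1) it by (simp add: m_assoc)
  have conj: "t \<otimes> (x \<otimes> y) \<otimes> t = (t \<otimes> x \<otimes> t) \<otimes> (t \<otimes> y \<otimes> t)"
    if "x \<in> carrier G" "y \<in> carrier G" for x y
  proof -
    have "(t \<otimes> x \<otimes> t) \<otimes> (t \<otimes> y \<otimes> t) = t \<otimes> x \<otimes> (t \<otimes> t) \<otimes> (y \<otimes> t)"
      using that t(1) by (simp add: m_assoc)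
    then show ?thesis using that t by (simp add: m_assoc)
  qed
  have tgt: "t \<otimes> g \<otimes> t = c \<otimes> g"
    using tg cc g(1) t by (simp add: m_assoc)
  have tct: "t \<otimes> c \<otimes> t = c" using c(2) cc t by (metis m_assoc r_one)
  have "c \<otimes> c = \<one>"
  proof -
    have "t \<otimes> (t \<otimes> g \<otimes> t) \<otimes> t = (t \<otimes> t) \<otimes> g \<otimes> (t \<otimes> t)"
      using t(1) g(1) by (simp add: m_assoc)
    then have "g = t \<otimes> (c \<otimes> g) \<otimes> t" using t g(1) tgt by simp
    also have "\<dots> = c \<otimes> c \<otimes> g" using conj[OF cc g(1)] tct tgt cc g(1) by (simp add: m_assoc)
    finally show ?thesis using cc g(1) by (metis l_cancel_one' m_closed r_cancel_one')
  qed
  moreover have "t \<otimes> g [^] n \<otimes> t = c [^] n \<otimes> g [^] n" for n :: nat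
  proof -
    have "t \<otimes> g [^] n \<otimes> t = (c \<otimes> g) [^] n"
    proof (induction n)
      case (Suc n)
      then show ?case using conj[of "g [^] n" g] g(1) tgt by simp
    qed (use t in simp)
    then show ?thesis using pow_mult_distrib[OF c(3) cc g(1)] by simp
  qed
  from this[of k] have "c [^] k = \<one>" using g t cc by simp
  moreover obtain j where j: "k = 2 * j + 1" using g(3) by (rule oddE)
  moreover have "c [^] (2 * j) = (c \<otimes> c) [^] j"
    using nat_pow_pow[OF cc, of 2 j] cc by (simp add: numeral_2_eq_2)
  ultimately show ?thesis using cc by simp
qed

text \<open>
  The commutator of \<open>t\<close> and \<open>g\<close> lies in every term of the lower central series: if it lies in one
  term, it becomes central modulo the next term \<open>N\<close>, and the previous lemma applied in \<open>G Mod N\<close>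
  shows that it is trivial there.
\<close>
lemma nilpotent_involution_commutes_odd:
  assumes nil: "nilpotent_group G"
    and t: "t \<in> carrier G" "t \<otimes> t = \<one>"
    and g: "g \<in> carrier G" "g [^] k = \<one>" "odd (k :: nat)"
  shows "t \<otimes> g = g \<otimes> t"
proof -
  define c where "c = t \<otimes> g \<otimes> inv t \<otimes> inv g"
  have cc: "c \<in> carrier G" unfolding c_def using t g by simp
  have "c \<in> lower_central G n" for n
  proof (induction n)
    case 0 show ?case using cc by simp
  next
    case (Suc n)
    define N where "N = lower_central G (Suc n)"
    interpret N: normal N G unfolding N_def by (rule lower_central_normal)
    let ?\<pi> = "\<lambda>x. N #> x"
    interpret \<pi>: group_hom G "G Mod N" ?\<pi>
      unfolding group_hom_def group_hom_axioms_def
      using N.r_coset_hom_Mod N.factorgroup_is_group is_group by blast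
    have ker: "x \<in> N" if "x \<in> carrier G" "?\<pi> x = \<one>\<^bsub>G Mod N\<^esub>" for x
      using that coset_join1[of N x] N.subgroup_axioms N.subset by simp
    have one: "?\<pi> x = \<one>\<^bsub>G Mod N\<^esub>" if "x \<in> N" for x
      using that coset_join2[of x N] N.subgroup_axioms N.mem_carrier by simp
    have central: "?\<pi> c \<otimes>\<^bsub>G Mod N\<^esub> ?\<pi> x = ?\<pi> x \<otimes>\<^bsub>G Mod N\<^esub> ?\<pi> c" if x: "x \<in> carrier G" for x
    proof -
      have "c \<otimes> x \<otimes> inv c \<otimes> inv x \<in> N"
        unfolding N_def using Suc x by (auto intro: commutator_in_commutator_subgroup)
      then have "?\<pi> (c \<otimes> x \<otimes> inv c \<otimes> inv x) = \<one>\<^bsub>G Mod N\<^esub>" by (rule one)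
      then show ?thesis
        using cc x \<pi>.H.commutator_eq_one_iff[of "?\<pi> c" "?\<pi> x"] by (simp del: mult_FactGroup)
    qed
    have "?\<pi> c = \<one>\<^bsub>G Mod N\<^esub>"
    proof (rule \<pi>.H.involution_odd_commutator_trivial)
      show "?\<pi> t \<in> carrier (G Mod N)" "?\<pi> g \<in> carrier (G Mod N)" using t g by (auto intro: \<pi>.hom_closed)
      show "?\<pi> t \<otimes>\<^bsub>G Mod N\<^esub> ?\<pi> t = \<one>\<^bsub>G Mod N\<^esub>"
        using \<pi>.hom_mult[OF t(1) t(1)] t(2) \<pi>.hom_one by metis
      show "?\<pi> g [^]\<^bsub>G Mod N\<^esub> k = \<one>\<^bsub>G Mod N\<^esub>"
        using \<pi>.hom_nat_pow[OF g(1), of k] g(2) \<pi>.hom_one by metis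
      show "?\<pi> c = ?\<pi> t \<otimes>\<^bsub>G Mod N\<^esub> ?\<pi> g \<otimes>\<^bsub>G Mod N\<^esub> inv\<^bsub>G Mod N\<^esub> ?\<pi> t \<otimes>\<^bsub>G Mod N\<^esub> inv\<^bsub>G Mod N\<^esub> ?\<pi> g"
        unfolding c_def using t g by (simp del: mult_FactGroup)
    qed (use g central t in auto)
    then show ?case using ker cc unfolding N_def by blast
  qed
  moreover obtain n where "lower_central G n = {\<one>}" using nil unfolding nilpotent_group_def by blast
  ultimately have "c = \<one>" by blast
  then show ?thesis unfolding c_def using commutator_eq_one_iff t g by blast
qed

lemma nilpotent_pair_involution_commutes_odd:
  assumes "nilpotent_pair G t g" "t \<in> carrier G" "t \<otimes> t = \<one>"
    "g \<in> carrier G" "g [^] k = \<one>" "odd (k :: nat)"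
  shows "t \<otimes> g = g \<otimes> t"
proof -
  let ?K = "generate G {t, g}"
  have K: "subgroup ?K G" using assms by (intro generate_is_subgroup) auto
  have "t \<in> ?K" "g \<in> ?K" by (auto intro: generate.incl)
  then show ?thesis
    using group.nilpotent_involution_commutes_odd[OF subgroup_imp_group[OF K], of t g k]
      assms(1,3,5,6) unfolding nilpotent_pair_def
    by (simp add: nat_pow_consistent[symmetric])
qed

text \<open>
  The conjugacy classes partition \<open>I\<close>, so one of them has odd size. Its size is the index of a
  centralizer, which by assumption contains every subgroup of odd order. An odd prime \<open>p\<close> dividing
  the index would contradict that the centralizer contains a Sylow \<open>p\<close>-subgroup.
\<close>
lemma odd_conj_invariant_set_contains_central:
  assumes fin: "finite (carrier G)" and I: "I \<subseteq> carrier G" "odd (card I)"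
    and conj: "\<And>t x. t \<in> I \<Longrightarrow> x \<in> carrier G \<Longrightarrow> x \<otimes> t \<otimes> inv x \<in> I"
    and comm: "\<And>t x k. t \<in> I \<Longrightarrow> x \<in> carrier G \<Longrightarrow> x [^] k = \<one> \<Longrightarrow> odd (k :: nat) \<Longrightarrow>
      t \<otimes> x = x \<otimes> t"
  shows "\<exists>t\<in>I. \<forall>x\<in>carrier G. t \<otimes> x = x \<otimes> t"
proof -
  let ?\<phi> = "\<lambda>g. \<lambda>h \<in> carrier G. g \<otimes> h \<otimes> inv g"
  interpret act: group_action G "carrier G" ?\<phi> by (rule action_by_conjugation)
  let ?orb = "orbit G ?\<phi>" and ?st = "stabilizer G ?\<phi>"
  have orbI: "?orb t \<subseteq> I" if "t \<in> I" for t
    using that conj I(1) unfolding orbit_def by auto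
  have mem: "t \<in> ?orb t" if "t \<in> I" for t
    using that I(1) act.orbit_refl by blast
  have "\<exists>t\<in>I. odd (card (?orb t))"
  proof (rule ccontr)
    assume "\<not> ?thesis"
    then have ev: "even (card X)" if "X \<in> ?orb ` I" for X using that by auto
    have U: "\<Union> (?orb ` I) = I" using orbI mem by blast
    have "2 dvd card (\<Union> (?orb ` I))"
    proof (rule dvd_partition)
      show "finite (\<Union> (?orb ` I))" using U I fin finite_subset by metis
      show "\<forall>X\<in>?orb ` I. 2 dvd card X" using ev by blast
      have "X \<inter> Y = {}" if XY: "X \<in> ?orb ` I" "Y \<in> ?orb ` I" "X \<noteq> Y" for X Y
      proof -
        have "X \<in> orbits G (carrier G) ?\<phi>" "Y \<in> orbits G (carrier G) ?\<phi>"
          using XY I(1) unfolding orbits_def by blast+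
        then show ?thesis using act.disjoint_union XY(3) by blast
      qed
      then show "\<forall>X\<in>?orb ` I. \<forall>Y\<in>?orb ` I. X \<noteq> Y \<longrightarrow> X \<inter> Y = {}" by blast
    qed
    then show False using U I(2) by simp
  qed
  then obtain t where t: "t \<in> I" "odd (card (?orb t))" by blast
  have tc: "t \<in> carrier G" using t I by blast
  have st: "?st t = {x \<in> carrier G. t \<otimes> x = x \<otimes> t}"
    unfolding stabilizer_def 
    using tc inv_solve_right'[of t "x \<otimes> t" x for x] by auto
  have prod: "card (?orb t) * card (?st t) = order G"
    by (rule act.orbit_stabilizer_theorem[OF tc])
  have sub: "subgroup (?st t) G" by (rule act.stabilizer_subgroup[OF tc])
  have "card (?orb t) = 1"
  proof (rule ccontr)
    assume "card (?orb t) \<noteq> 1"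
    then obtain p where p: "prime p" "p dvd card (?orb t)" using prime_factor_nat by blast
    have odd_p: "odd p" using p(2) t(2) dvd_trans by blast
    have ord0: "order G \<noteq> 0" using fin order_gt_0_iff_finite by simp
    define a where "a = multiplicity p (order G)"
    obtain r where r: "order G = p ^ a * r"
      using multiplicity_dvd[of p "order G"] unfolding a_def by blast
    obtain P where P: "subgroup P G" "card P = p ^ a"
      using sylow_thm[OF p(1) is_group r fin] by blast
    have "P \<subseteq> ?st t"
    proof
      fix x assume x: "x \<in> P"
      have xc: "x \<in> carrier G" using P(1) x subgroup.mem_carrier by fast
      have "x [^]\<^bsub>G\<lparr>carrier := P\<rparr>\<^esub> order (G\<lparr>carrier := P\<rparr>) = \<one>\<^bsub>G\<lparr>carrier := P\<rparr>\<^esub>"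
        using x by (intro group.pow_order_eq_1 subgroup_imp_group P) simp
      then have "x [^] (p ^ a) = \<one>"
        using P(2) by (simp add: order_def nat_pow_consistent[symmetric])
      then show "x \<in> ?st t"
        using comm[OF t(1) xc, of "p ^ a"] odd_p xc st by simp
    qed
    then have "subgroup P (G\<lparr>carrier := ?st t\<rparr>)"
      using P(1) sub subgroup_incl by blast
    then have "card (rcosets\<^bsub>G\<lparr>carrier := ?st t\<rparr>\<^esub> P) * card P = card (?st t)"
      using group.lagrange[OF subgroup_imp_group[OF sub], of P] by (simp add: order_def)
    then have "card P dvd card (?st t)" by (intro dvdI[OF trans[OF sym mult.commute]])
    then have "p ^ a * p dvd order G"
      using mult_dvd_mono[OF _ p(2), of "p ^ a" "card (?st t)"] P(2) prod by (simp add: mult.commute)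
    then have "p ^ Suc a dvd order G" by (simp add: mult.commute)
    then have "Suc a \<le> a" unfolding a_def using p(1) ord0
      by (intro multiplicity_geI) auto
    then show False by simp
  qed
  then have "card (?st t) = card (carrier G)" using prod by (simp add: order_def)
  then have "?st t = carrier G"
    using fin subgroup.subset[OF sub] card_subset_eq by blast
  then show ?thesis using st t(1) by blast
qed

end

section \<open>The nilpotentizer\<close>

context group_hom
begin

lemma commutator_subgroup_img:
  assumes "A \<subseteq> carrier G" "B \<subseteq> carrier G"
  shows "commutator_subgroup H (h ` A) (h ` B) = h ` commutator_subgroup G A B"
proof -
  have "(\<Union>x\<in>h ` A. \<Union>y\<in>h ` B. {x \<otimes>\<^bsub>H\<^esub> y \<otimes>\<^bsub>H\<^esub> inv\<^bsub>H\<^esub> x \<otimes>\<^bsub>H\<^esub> inv\<^bsub>H\<^esub> y}) =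
      (\<Union>x\<in>A. \<Union>y\<in>B. {h (x \<otimes> y \<otimes> inv x \<otimes> inv y)})"
    using assms by (auto simp: subset_iff)
  also have "\<dots> = h ` (\<Union>x\<in>A. \<Union>y\<in>B. {x \<otimes> y \<otimes> inv x \<otimes> inv y})" by auto
  finally show ?thesis
    unfolding commutator_subgroup_def
    using generate_img[OF G.commutators_in_carrier[OF assms]] by simp
qed

text \<open>
  A homomorphism maps the lower central series of the subgroup generated by \<open>x\<close> and \<open>y\<close> onto that of
  the subgroup generated by their images. It is applied below to inner automorphisms.
\<close>
lemma nilpotent_pair_img:
  assumes "nilpotent_pair G x y" "x \<in> carrier G" "y \<in> carrier G"
  shows "nilpotent_pair H (h x) (h y)"
proof -
  let ?K = "generate G {x, y}" and ?L = "generate H {h x, h y}"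
  have K: "subgroup ?K G" using assms by (intro G.generate_is_subgroup) auto
  have L: "subgroup ?L H" using assms by (intro H.generate_is_subgroup) auto
  have LK: "?L = h ` ?K" using generate_img[of "{x, y}"] assms by simp
  have "lower_central (H\<lparr>carrier := ?L\<rparr>) n = h ` lower_central (G\<lparr>carrier := ?K\<rparr>) n" for n
  proof (induction n)
    case 0 show ?case using LK by simp
  next
    case (Suc n)
    have "lower_central (G\<lparr>carrier := ?K\<rparr>) n \<subseteq> carrier G"
      using group.lower_central_in_carrier[OF G.subgroup_imp_group[OF K], of n]
        subgroup.subset[OF K] by auto
    then show ?case
      unfolding G.lower_central_subgroup_Suc[OF K] H.lower_central_subgroup_Suc[OF L] Suc
      using commutator_subgroup_img subgroup.subset[OF K] LK by simp
  qed
  moreover obtain n where "lower_central (G\<lparr>carrier := ?K\<rparr>) n = {\<one>}"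
    using assms(1) G.nilpotent_subgroup_iff[OF K] unfolding nilpotent_pair_def by blast
  ultimately have "lower_central (H\<lparr>carrier := ?L\<rparr>) n = {\<one>\<^bsub>H\<^esub>}" by simp
  then show ?thesis
    unfolding nilpotent_pair_def using H.nilpotent_subgroup_iff[OF L] by blast
qed

end

context group
begin

lemma nilpotent_pair_sym: "nilpotent_pair G g h \<longleftrightarrow> nilpotent_pair G h g"
  unfolding nilpotent_pair_def by (simp add: insert_commute)

lemma nilpotent_pair_cyclic:
  assumes "a \<in> carrier G" "g \<in> generate G {a}" "h \<in> generate G {a}"
  shows "nilpotent_pair G g h"
  unfolding nilpotent_pair_def
proof (rule commutative_subgroup_nilpotent)
  have A: "subgroup (generate G {a}) G" using assms(1) by (intro generate_is_subgroup) auto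
  then show "subgroup (generate G {g, h}) G"
    using assms subgroup.mem_carrier[OF A] by (intro generate_is_subgroup) auto
  have sub: "generate G {g, h} \<subseteq> generate G {a}"
    using assms A by (intro generate_subgroup_incl) auto
  fix x y assume "x \<in> generate G {g, h}" "y \<in> generate G {g, h}"
  then obtain i j :: int where "x = a [^] i" "y = a [^] j"
    using sub generate_pow[OF assms(1)] by blast
  then show "x \<otimes> y = y \<otimes> x"
    using assms(1) by (simp add: int_pow_mult[symmetric] add.commute)
qed

lemma one_in_nilpotentizer: "\<one> \<in> nilpotentizer G"
  unfolding nilpotentizer_def
  by (auto intro: nilpotent_pair_cyclic generate.one generate.incl)

text \<open>An element and its inverse generate the same subgroup together with any \<open>h\<close>.\<close>
lemma nilpotentizer_inv:
  assumes "g \<in> nilpotentizer G"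
  shows "inv g \<in> nilpotentizer G"
proof -
  have g: "g \<in> carrier G" using assms unfolding nilpotentizer_def by simp
  have "nilpotent_pair G (inv g) h" if h: "h \<in> carrier G" for h
  proof -
    have "generate G {inv g, h} \<subseteq> generate G {g, h}"
      using g h by (intro generate_subgroup_incl generate_is_subgroup) (auto intro: generate.incl generate.inv)
    moreover have "generate G {g, h} \<subseteq> generate G {inv g, h}"
      using g h generate.inv[of "inv g" "{inv g, h}" G]
      by (intro generate_subgroup_incl generate_is_subgroup) (auto intro: generate.incl)
    ultimately show ?thesis
      using assms h unfolding nilpotentizer_def nilpotent_pair_def by auto
  qed
  then show ?thesis using g unfolding nilpotentizer_def by simp
qed

text \<open>
  Conjugating the pair \<open>g, h'\<close>, where \<open>h'\<close> is the preimage of \<open>h\<close> under conjugation by \<open>x\<close>, gives the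
  pair of the conjugate of \<open>g\<close> and \<open>h\<close>.
\<close>
lemma nilpotentizer_conj:
  assumes "g \<in> nilpotentizer G" "x \<in> carrier G"
  shows "x \<otimes> g \<otimes> inv x \<in> nilpotentizer G"
proof -
  have g: "g \<in> carrier G" using assms unfolding nilpotentizer_def by simp
  let ?\<phi> = "\<lambda>y. x \<otimes> y \<otimes> inv x"
  interpret \<phi>: group_hom G G ?\<phi> by (rule conjugation_group_hom[OF assms(2)])
  have "nilpotent_pair G (?\<phi> g) h" if h: "h \<in> carrier G" for h
  proof -
    have "nilpotent_pair G g (inv x \<otimes> h \<otimes> x)"
      using assms h unfolding nilpotentizer_def by simp
    then have "nilpotent_pair G (?\<phi> g) (?\<phi> (inv x \<otimes> h \<otimes> x))"
      using assms h g by (intro \<phi>.nilpotent_pair_img) auto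
    then show ?thesis using conjugation_is_surj[OF assms(2) h] by simp
  qed
  then show ?thesis using g assms(2) unfolding nilpotentizer_def by simp
qed

lemma nilpotent_pair_mult_central_involution:
  assumes nil: "nilpotent_pair G g h" and gh: "g \<in> carrier G" "h \<in> carrier G"
    and t: "t \<in> carrier G" "t \<otimes> t = \<one>" "\<And>x. x \<in> carrier G \<Longrightarrow> t \<otimes> x = x \<otimes> t"
  shows "nilpotent_pair G g (h \<otimes> t)"
  unfolding nilpotent_pair_def
proof (rule nilpotent_subgroup_mult_central)
  let ?K = "generate G {g, h}" and ?Z = "{\<one>, t}"
  show K: "subgroup ?K G" using gh by (intro generate_is_subgroup) auto
  show "subgroup (generate G {g, h \<otimes> t}) G" using gh t(1) by (intro generate_is_subgroup) auto
  have "inv t = t" using t(1,2) by (simp add: inv_equality)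
  then show Z: "subgroup ?Z G" using t(1,2) by unfold_locales auto
  show comm: "z \<otimes> u = u \<otimes> z" if "z \<in> ?Z" "u \<in> carrier G" for z u
    using that t(3)[of u] by auto
  have KZ: "subgroup (?K <#> ?Z) G"
  proof -
    have "?Z \<lhd> G"
    proof (rule normal_invI[OF Z])
      fix x z assume x: "x \<in> carrier G" and z: "z \<in> ?Z"
      then have "z \<in> carrier G" using t(1) by auto
      then have "x \<otimes> z \<otimes> inv x = z" using x by (simp add: m_assoc flip: comm[OF z x])
      then show "x \<otimes> z \<otimes> inv x \<in> ?Z" using z by simp
    qed
    then show ?thesis using mult_norm_subgroup K commut_normal by metis
  qed
  have "g = g \<otimes> \<one>" using gh by simp
  then have "g \<in> ?K <#> ?Z" "h \<otimes> t \<in> ?K <#> ?Z"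
    unfolding set_mult_def using generate.incl[of _ "{g, h}" G] by blast+
  then show "generate G {g, h \<otimes> t} \<subseteq> ?K <#> ?Z"
    using KZ by (intro generate_subgroup_incl) auto
  show "nilpotent_group (G\<lparr>carrier := ?K\<rparr>)" using nil unfolding nilpotent_pair_def .
qed

text \<open>
  Inversion acts on the nilpotentizer, and its fixed points are \<open>\<one>\<close> and the elements of order 2. The
  latter thus form a set of odd size to which \<open>odd_conj_invariant_set_contains_central\<close> applies.
\<close>
lemma even_nilpotentizer_central_involution:
  assumes fin: "finite (carrier G)" and ev: "even (card (nilpotentizer G))"
  shows "\<exists>t\<in>carrier G. t \<noteq> \<one> \<and> t \<otimes> t = \<one> \<and> (\<forall>x\<in>carrier G. t \<otimes> x = x \<otimes> t)"
proof -
  let ?N = "nilpotentizer G"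
  have sub: "?N \<subseteq> carrier G" unfolding nilpotentizer_def by blast
  define I where "I = {t \<in> ?N. inv t = t} - {\<one>}"
  have finN: "finite {t \<in> ?N. inv t = t}" using sub fin finite_subset by fastforce
  have "even (card {t \<in> ?N. inv t = t})"
    using even_card_involution_iff[of ?N "m_inv G"] ev fin finite_subset[OF sub]
      nilpotentizer_inv sub by (auto simp: subset_iff)
  moreover have "card {t \<in> ?N. inv t = t} = Suc (card I)"
    unfolding I_def using finN one_in_nilpotentizer by (subst card.remove[of _ \<one>]) auto
  ultimately have odd: "odd (card I)" by simp
  have I: "t \<in> carrier G" "t \<in> ?N" "inv t = t" "t \<noteq> \<one>" "t \<otimes> t = \<one>" if "t \<in> I" for t
  proof -
    show t: "t \<in> carrier G" "t \<in> ?N" "inv t = t" "t \<noteq> \<one>" using that sub unfolding I_def by auto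
    show "t \<otimes> t = \<one>" using r_inv[OF t(1)] t(3) by simp
  qed
  have "\<exists>t\<in>I. \<forall>x\<in>carrier G. t \<otimes> x = x \<otimes> t"
  proof (rule odd_conj_invariant_set_contains_central[OF fin _ odd])
    show "I \<subseteq> carrier G" using I(1) by blast
    fix t x assume t: "t \<in> I" and x: "x \<in> carrier G"
    have "inv (x \<otimes> t \<otimes> inv x) = x \<otimes> t \<otimes> inv x"
      using x I[OF t] by (simp add: inv_mult_group m_assoc)
    moreover have "x \<otimes> t \<otimes> inv x \<noteq> \<one>"
      using x I(1,4)[OF t] inv_solve_right'[of "\<one>" "x \<otimes> t" x] by auto
    ultimately show "x \<otimes> t \<otimes> inv x \<in> I"
      unfolding I_def using nilpotentizer_conj[OF I(2)[OF t] x] by simp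
    fix k :: nat assume k: "x [^] k = \<one>" "odd k"
    have "nilpotent_pair G t x" using I(2)[OF t] x unfolding nilpotentizer_def by simp
    then show "t \<otimes> x = x \<otimes> t"
      using nilpotent_pair_involution_commutes_odd I[OF t] x k by blast
  qed
  then show ?thesis using I by blast
qed

text \<open>
  The group generated by \<open>g\<close> and \<open>g\<close> is cyclic, so \<open>g\<close> is among the elements counted on the right
  although it is not its own neighbour; this is the summand 1 that makes the degrees odd.
\<close>
lemma card_edges_nilpotent_graph_at_vertex:
  assumes fin: "finite (carrier G)" and g: "g \<in> carrier G - nilpotentizer G"
  shows "card {e \<in> snd (nilpotent_graph G). g \<in> e} + Suc (card (nilpotentizer G)) =
    card {h \<in> carrier G. nilpotent_pair G g h}"
proof -
  let ?N = "nilpotentizer G" and ?D = "{h \<in> carrier G. nilpotent_pair G g h}"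
  have "{e \<in> snd (nilpotent_graph G). g \<in> e} = (\<lambda>h. {g, h}) ` (?D - insert g ?N)"
    using g unfolding nilpotent_graph_def
    by (auto simp: insert_commute nilpotent_pair_sym)
  moreover have "inj_on (\<lambda>h. {g, h}) (?D - insert g ?N)"
    by (auto simp: inj_on_def doubleton_eq_iff)
  ultimately have "card {e \<in> snd (nilpotent_graph G). g \<in> e} = card (?D - insert g ?N)"
    by (simp add: card_image)
  moreover have sub: "insert g ?N \<subseteq> ?D"
    using g nilpotent_pair_sym nilpotent_pair_cyclic[of g g g]
    unfolding nilpotentizer_def by (auto intro: generate.incl)
  moreover have "finite ?N" using fin unfolding nilpotentizer_def by simp
  then have "card (insert g ?N) = Suc (card ?N)" using g by simp
  moreover have "card (insert g ?N) \<le> card ?D" using sub fin by (intro card_mono) auto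
  ultimately show ?thesis using \<open>finite ?N\<close> by (simp add: card_Diff_subset)
qed

text \<open>Multiplication by a central element of order 2 pairs off the elements of the set.\<close>
lemma even_card_nilpotent_partners:
  assumes fin: "finite (carrier G)" and ev: "even (card (nilpotentizer G))" and g: "g \<in> carrier G"
  shows "even (card {h \<in> carrier G. nilpotent_pair G g h})"
proof -
  obtain t where t: "t \<in> carrier G" "t \<noteq> \<one>" "t \<otimes> t = \<one>" "\<And>x. x \<in> carrier G \<Longrightarrow> t \<otimes> x = x \<otimes> t"
    using even_nilpotentizer_central_involution[OF fin ev] by blast
  show ?thesis
  proof (rule even_card_involution_moved[where f = "\<lambda>h. h \<otimes> t"])
    show "finite {h \<in> carrier G. nilpotent_pair G g h}" using fin by simp
    fix h assume h: "h \<in> {h \<in> carrier G. nilpotent_pair G g h}"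
    then show "h \<otimes> t \<in> {h \<in> carrier G. nilpotent_pair G g h}"
      using nilpotent_pair_mult_central_involution[OF _ g _ t(1,3,4)] t(1) by simp
    show "h \<otimes> t \<otimes> t = h" using h t(1,3) by (simp add: m_assoc)
    show "h \<otimes> t \<noteq> h" using h t(1,2) by simp
  qed
qed

end

theorem proposition6p8:
  fixes G :: "('a, 'b) monoid_scheme"
  assumes "group G"
    and "finite (carrier G)"
    and "\<not> nilpotent_group G"
    and "even (card (nilpotentizer G))"
  shows "\<not> eulerian (nilpotent_graph G)"
proof
  interpret group G by fact
  assume eul: "eulerian (nilpotent_graph G)"
  then obtain w where "w \<noteq> []" "set w = carrier G - nilpotentizer G"
    unfolding eulerian_def nilpotent_graph_def by auto
  then have "carrier G - nilpotentizer G \<noteq> {}" by (metis set_empty)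
  then obtain g where g: "g \<in> carrier G - nilpotentizer G" by blast
  have "{x} \<notin> snd (nilpotent_graph G)" for x
    unfolding nilpotent_graph_def by (auto simp: doubleton_eq_iff)
  then have "even (card {e \<in> snd (nilpotent_graph G). g \<in> e})"
    by (rule eulerian_even_degree[OF eul])
  moreover have "even (card {h \<in> carrier G. nilpotent_pair G g h})"
    using even_card_nilpotent_partners assms(2,4) g by blast
  ultimately show False
    using card_edges_nilpotent_graph_at_vertex[OF assms(2) g] assms(4) by presburger
qed

end
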